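(* Let $X$ and $Y$ be random variables with distributions $F$ and $G$ respectively, where $F$ has as support the whole real axis and $G(0-)=0$, $G(0)<1$. Let $H$ be the distribution of $XY$. Suppose that (A) for any $c>0$, $\overline{G}(cx)=o[\overline{H}(x)]$ as $x\to\infty$; (B) there exists a function $h:[0,\infty)\to(0,\infty)$ such that $\mathbf{P}[X>x\mid Y=y]\sim h(y)\,\mathbf{P}[X>x]$ as $x\to\infty$, uniformly for $y\in S_Y$. Then: (1) if $F\in\mathcal{OS}$, then $H\in\mathcal{OS}$; (2) if $F\in\mathcal{OA}$, then $H\in\mathcal{OA}$.
   Context: For a distribution $F$ write $\overline{F}:=1-F$; throughout $\overline{F}(x)>0$ for all $x\ge 0$. $H(x):=\mathbf{P}[XY\le x]$. $S_Y$ is the support of $Y$. Uniformity in (B) means $\lim_{x\to\infty}\sup_{y\in S_Y}\left|\frac{\mathbf{P}[X>x\mid Y=y]}{h(y)\mathbf{P}[X>x]}-1\right|=0$. $F\in\mathcal{OS}$ (generalized subexponential) if $\limsup_{x\to\infty}\overline{F^{2*}}(x)/\overline{F}(x)<\infty$, where $F^{2*}=F*F$ is the convolution. $F\in\mathcal{P_D}$ if for all (equivalently, for some) $v>1$, $\limsup_{x\to\infty}\overline{F}(vx)/\overline{F}(x)<1$. $\mathcal{OA}:=\mathcal{OS}\cap\mathcal{P_D}$. *)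

theory Defs
  imports "HOL-Probability.Probability" "HOL-Library.Landau_Symbols"
begin

definition tail :: "real measure \<Rightarrow> real \<Rightarrow> real" where
  "tail F x = 1 - cdf F x"

definition supp :: "real measure \<Rightarrow> real set" where
  "supp F = {x. \<forall>U. open U \<longrightarrow> x \<in> U \<longrightarrow> measure F U > 0}"

text \<open>
  A distribution is a Borel probability measure on the whole real line. Both classes below
  consist of distributions whose tail vanishes at no \<open>x \<ge> 0\<close>, so the ratios of
  tails are eventually genuine quotients.
\<close>

definition class_OS :: "real measure set" where
  "class_OS = {F. real_distribution F \<and> (\<forall>x\<ge>0. tail F x > 0) \<and>
     Limsup at_top (\<lambda>x. ereal (tail (F \<star> F) x / tail F x)) < \<infinity>}"

text \<open>
  The condition is imposed for every \<open>v > 1\<close>. Requiring it for a single \<open>v > 1\<close>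
  would be weaker for a general distribution: the tail may be nearly constant between
  consecutive powers of \<open>2\<close>.
\<close>

definition class_PD :: "real measure set" where
  "class_PD = {F. real_distribution F \<and> (\<forall>x\<ge>0. tail F x > 0) \<and>
     (\<forall>v>1. Limsup at_top (\<lambda>x. ereal (tail F (v * x) / tail F x)) < 1)}"

definition class_OA :: "real measure set" where
  "class_OA = class_OS \<inter> class_PD"

text \<open>
  \<open>K\<close> is a regular conditional distribution of \<open>X\<close> given \<open>Y\<close>: a probability kernel
  such that \<open>K y A\<close> is a version of \<open>P[X \<in> A | Y = y]\<close>.
\<close>

definition regular_cond_distr ::
    "'a measure \<Rightarrow> ('a \<Rightarrow> real) \<Rightarrow> ('a \<Rightarrow> real) \<Rightarrow> (real \<Rightarrow> real measure) \<Rightarrow> bool" where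
  "regular_cond_distr M X Y K \<longleftrightarrow>
     K \<in> borel \<rightarrow>\<^sub>M prob_algebra borel \<and>
     (\<forall>A\<in>sets borel. \<forall>B\<in>sets borel.
        measure M {\<omega> \<in> space M. X \<omega> \<in> A \<and> Y \<omega> \<in> B} =
        set_lebesgue_integral (distr M borel Y) B (\<lambda>y. measure (K y) A))"

end

theory Submission
  imports Defs
begin

text \<open>
  Write \<open>V \<preceq> T\<close> (below: \<open>tail_dom V T\<close>) when the tail of \<open>V\<close> is at most a constant times
  the tail of \<open>T\<close> on the whole line. Since
  \<open>(V \<star> W) {x<..} = \<integral> V {x - u<..} dW(u)\<close>, replacing first one factor and then the
  other shows that \<open>V \<preceq> T\<close> implies \<open>V \<star> V \<preceq> T \<star> T\<close>. Generalized
  subexponentiality of \<open>F\<close>, whose tail is positive, says exactly \<open>F \<star> F \<preceq> F\<close>. Hence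
  it passes from \<open>T\<close> to \<open>H\<close> as soon as \<open>H \<preceq> T \<preceq> H\<close>, and for the first claim it
  suffices to find a comparison measure \<open>T\<close> for which \<open>T \<star> T \<preceq> T\<close> is easy.

  The right \<open>T\<close> belongs to a product with independent factors. By the uniform asymptotics,
  past some level \<open>u0\<close> the tail of \<open>X\<close> given \<open>Y = y\<close> is, up to constants, a factor depending on
  \<open>y\<close> times the tail of \<open>X\<close>; the measurable function
  \<open>w(y) = P[X > u0 | Y = y]\<close> serves as this factor in place of \<open>h\<close>, of which no
  measurability is known. Let \<open>T\<close> be the image under multiplication of the product of
  the law of \<open>X\<^sup>+\<close> and the finite measure \<open>w dG\<close> on \<open>{0<..}\<close>. Total masses only
  affect constants, so \<open>w dG\<close> is left unnormalized.

  For nonnegative \<open>x\<^sub>1, x\<^sub>2\<close> one has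
  \<open>x\<^sub>1 y\<^sub>1 + x\<^sub>2 y\<^sub>2 \<le> (x\<^sub>1 + x\<^sub>2) max(y\<^sub>1, y\<^sub>2)\<close>. For independent
  factors this bounds the tail of \<open>T \<star> T\<close> by a multiple of the mixture over \<open>y\<close> of the
  tails of \<open>X\<^sub>1\<^sup>+ + X\<^sub>2\<^sup>+\<close> at \<open>x / y\<close>, so that \<open>F \<star> F \<preceq> F\<close> gives
  \<open>T \<star> T \<preceq> T\<close> (lemma \<open>tail_dom_convolution_prod_law\<close>).

  The tail of \<open>H\<close> at \<open>t\<close> is the integral over \<open>y > 0\<close> of the conditional tails of
  \<open>X\<close> at \<open>t / y\<close> (\<open>H_tail_eq\<close>). The asymptotics say nothing when \<open>t / y < u0\<close>, but
  such \<open>y\<close> contribute at most \<open>G {t / u0<..}\<close>, which is \<open>o(H {t<..})\<close> and can be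
  absorbed on the left (\<open>H_tail_split\<close>). This yields \<open>H \<preceq> T\<close>; the converse needs
  no absorption, because a conditional tail is at least \<open>w(y)\<close> to the left of \<open>u0\<close>.

  The second claim uses the same splitting. If the tail of \<open>F\<close> loses a fixed fraction between
  \<open>u\<close> and \<open>v u\<close>, then by the uniform asymptotics so do all conditional tails past one
  common level, and integration over \<open>y\<close> transfers this to \<open>H\<close>.
\<close>

section \<open>Domination of tails\<close>

lemma real_distribution_emeasure_tail:
  assumes "real_distribution F"
  shows "emeasure F {t<..} = ennreal (tail F t)"
proof -
  interpret real_distribution F by fact
  have "measure F {t<..} = 1 - measure F {..t}"
    using prob_compl[of "{..t}"] by (simp add: Compl_eq_Diff_UNIV[symmetric] Compl_atMost)
  then show ?thesis by (simp add: emeasure_eq_measure tail_def cdf_def)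
qed

text \<open>
  The bound is required on the whole line, not only near infinity: the convolution formula
  evaluates tails at all arguments \<open>x - u\<close>.
\<close>

definition tail_dom :: "real measure \<Rightarrow> real measure \<Rightarrow> bool" where
  "tail_dom V T \<longleftrightarrow> (\<exists>C<\<top>. \<forall>t. emeasure V {t<..} \<le> C * emeasure T {t<..})"

lemma tail_dom_trans:
  assumes "tail_dom U V" "tail_dom V T" shows "tail_dom U T"
proof -
  obtain C D where C: "C < \<top>" "\<And>t. emeasure U {t<..} \<le> C * emeasure V {t<..}"
    and D: "D < \<top>" "\<And>t. emeasure V {t<..} \<le> D * emeasure T {t<..}"
    using assms unfolding tail_dom_def by auto
  have "emeasure U {t<..} \<le> (C * D) * emeasure T {t<..}" for t
    using order_trans[OF C(2)[of t] mult_left_mono[OF D(2)[of t], of C]] by (simp add: mult.assoc)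
  moreover have "C * D < \<top>" using C(1) D(1) by (simp add: ennreal_mult_less_top)
  ultimately show ?thesis unfolding tail_dom_def by blast
qed

text \<open>
  A bound near infinity extends to the whole line: left of \<open>t0\<close> the tail of \<open>V\<close> is at most
  its total mass, and that of \<open>T\<close> at least its positive value at \<open>t0\<close>.
\<close>

lemma tail_domI_eventually:
  assumes "finite_borel_measure V" "finite_borel_measure T"
    and pos: "\<And>t. emeasure T {t<..} > 0"
    and C: "C < \<top>" and ev: "\<And>t. t \<ge> t0 \<Longrightarrow> emeasure V {t<..} \<le> C * emeasure T {t<..}"
  shows "tail_dom V T"
proof -
  interpret V: finite_borel_measure V by fact
  interpret T: finite_borel_measure T by fact
  define D where "D = emeasure V UNIV / emeasure T {t0<..}"
  have V_UNIV: "emeasure V UNIV < \<top>"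
    using V.emeasure_finite[of UNIV] by (simp add: less_top[symmetric])
  have D: "D < \<top>"
    unfolding D_def using V_UNIV pos[of t0]
    by (auto simp: ennreal_divide_eq_top_iff less_top[symmetric])
  have "emeasure V {t<..} \<le> (C + D) * emeasure T {t<..}" for t
  proof (cases "t \<ge> t0")
    case True
    then show ?thesis using order_trans[OF ev[OF True]] by (simp add: distrib_right)
  next
    case False
    have "emeasure V {t<..} \<le> emeasure V UNIV" by (intro emeasure_mono) auto
    also have "\<dots> = D * emeasure T {t0<..}"
      unfolding D_def using pos[of t0] T.emeasure_finite[of "{t0<..}"]
      by (metis ennreal_divide_times ennreal_divide_self ennreal_zero_less_top mult.right_neutral
           less_irrefl mult_divide_eq_ennreal ennreal_times_divide mult.commute)
    also have "\<dots> \<le> D * emeasure T {t<..}"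
      using False by (intro mult_left_mono emeasure_mono) auto
    also have "\<dots> \<le> (C + D) * emeasure T {t<..}" by (simp add: distrib_right)
    finally show ?thesis .
  qed
  moreover have "C + D < \<top>" using C D by simp
  ultimately show ?thesis unfolding tail_dom_def by blast
qed

lemma emeasure_convolution_tail:
  assumes "finite_borel_measure V" "finite_borel_measure T"
  shows "emeasure (V \<star> T) {x<..} = (\<integral>\<^sup>+u. emeasure T {x - u<..} \<partial>V)"
proof -
  interpret V: finite_borel_measure V by fact
  interpret T: finite_borel_measure T by fact
  have "{a. a + u \<in> {x<..}} = {x - u<..}" for u :: real by auto
  then show ?thesis
    by (subst convolution_emeasure)
       (auto simp: V.finite_measure_axioms T.finite_measure_axioms V.M_is_borel T.M_is_borel
         sets_eq_imp_space_eq[OF V.M_is_borel] sets_eq_imp_space_eq[OF T.M_is_borel])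
qed

text \<open>
  The convolution formula integrates the tail of the second factor against the first, so the
  second factor may be replaced. Commutativity brings the other copy of \<open>V\<close> into that place.
\<close>

lemma tail_dom_convolution:
  assumes V: "finite_borel_measure V" and T: "finite_borel_measure T" and "tail_dom V T"
  shows "tail_dom (V \<star> V) (T \<star> T)"
proof -
  interpret V: finite_borel_measure V by fact
  interpret T: finite_borel_measure T by fact
  note [measurable_cong] = V.M_is_borel T.M_is_borel
  obtain C where C: "C < \<top>" "\<And>t. emeasure V {t<..} \<le> C * emeasure T {t<..}"
    using assms(3) unfolding tail_dom_def by auto
  have swap: "emeasure (W \<star> V) {x<..} \<le> C * emeasure (W \<star> T) {x<..}"
    if W: "finite_borel_measure W" for W x
  proof -
    interpret W: finite_borel_measure W by fact
    note [measurable_cong] = W.M_is_borel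
    have "emeasure (W \<star> V) {x<..} = (\<integral>\<^sup>+u. emeasure V {x - u<..} \<partial>W)"
      by (rule emeasure_convolution_tail[OF W V])
    also have "\<dots> \<le> (\<integral>\<^sup>+u. C * emeasure T {x - u<..} \<partial>W)"
      by (intro nn_integral_mono C)
    also have "\<dots> = C * (\<integral>\<^sup>+u. emeasure T {x - u<..} \<partial>W)"
    proof (rule nn_integral_cmult)
      have "(\<lambda>u. emeasure T {x - u<..}) = (\<lambda>u. \<integral>\<^sup>+a. indicator {x<..} (a + u) \<partial>T)"
      proof
        fix u
        have "(\<lambda>a. indicator {x<..} (a + u) :: ennreal) = indicator {x - u<..}"
          by (auto simp: indicator_def fun_eq_iff)
        then show "emeasure T {x - u<..} = (\<integral>\<^sup>+a. indicator {x<..} (a + u) \<partial>T)" by simp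
      qed
      then show "(\<lambda>u. emeasure T {x - u<..}) \<in> borel_measurable W"
        by simp
    qed
    also have "\<dots> = C * emeasure (W \<star> T) {x<..}"
      by (simp add: emeasure_convolution_tail[OF W T])
    finally show ?thesis .
  qed
  have comm: "(V \<star> T) = (T \<star> V)"
    by (rule convolution_commutative)
       (simp_all add: V.finite_measure_axioms T.finite_measure_axioms V.M_is_borel T.M_is_borel)
  have "emeasure (V \<star> V) {x<..} \<le> (C * C) * emeasure (T \<star> T) {x<..}" for x
    using order_trans[OF swap[OF V, of x, unfolded comm] mult_left_mono[OF swap[OF T, of x], of C]]
    by (simp add: mult.assoc)
  moreover have "C * C < \<top>" using C by (simp add: ennreal_mult_less_top)
  ultimately show ?thesis unfolding tail_dom_def by blast
qed

section \<open>Generalized subexponentiality as domination\<close>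

lemma class_OS_iff_tail_dom:
  assumes F: "real_distribution F" and pos: "\<And>t. tail F t > 0"
  shows "F \<in> class_OS \<longleftrightarrow> tail_dom (F \<star> F) F"
proof -
  interpret real_distribution F by fact
  have FF: "real_distribution (F \<star> F)"
    unfolding convolution_def
    by (intro prob_space.real_distribution_distr prob_space_pair prob_space_axioms) simp
  interpret FF: real_distribution "F \<star> F" by (rule FF)
  note tails = real_distribution_emeasure_tail[OF F] real_distribution_emeasure_tail[OF FF]
  have nonneg: "tail (F \<star> F) t \<ge> 0" for t
    unfolding tail_def using FF.cdf_bounded_prob[of t] by simp
  show ?thesis
  proof
    assume "F \<in> class_OS"
    then have "Limsup at_top (\<lambda>x. ereal (tail (F \<star> F) x / tail F x)) < \<infinity>"
      by (simp add: class_OS_def)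
    then obtain c where c: "Limsup at_top (\<lambda>x. ereal (tail (F \<star> F) x / tail F x)) < ereal c"
      using less_PInf_Ex_of_nat by auto
    obtain t0 where t0: "\<And>t. t \<ge> t0 \<Longrightarrow> tail (F \<star> F) t / tail F t < c"
      using Limsup_lessD[OF c] by (auto simp: eventually_at_top_linorder)
    show "tail_dom (F \<star> F) F"
    proof (rule tail_domI_eventually[where C = "ennreal c" and ?t0.0 = t0])
      fix t assume "t \<ge> t0"
      from t0[OF this] have "tail (F \<star> F) t \<le> c * tail F t"
        using pos[of t] by (simp add: field_simps)
      then show "emeasure (F \<star> F) {t<..} \<le> ennreal c * emeasure F {t<..}"
        using pos[of t] unfolding tails
        by (metis ennreal_leI ennreal_mult'' less_imp_le)
    qed (use pos in \<open>auto simp: tails FF.finite_borel_measure_M finite_borel_measure_M\<close>)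
  next
    assume "tail_dom (F \<star> F) F"
    then obtain C where C: "C < \<top>" "\<And>t. emeasure (F \<star> F) {t<..} \<le> C * emeasure F {t<..}"
      unfolding tail_dom_def by auto
    define c where "c = enn2real C"
    have c: "C = ennreal c" "c \<ge> 0" using C by (auto simp: c_def)
    have "tail (F \<star> F) t / tail F t \<le> c" for t
      using C(2)[of t] pos[of t] c unfolding tails
      by (simp add: ennreal_mult''[symmetric] divide_le_eq)
    then have "Limsup at_top (\<lambda>x. ereal (tail (F \<star> F) x / tail F x)) \<le> ereal c"
      by (intro Limsup_bounded) auto
    then have "Limsup at_top (\<lambda>x. ereal (tail (F \<star> F) x / tail F x)) < \<infinity>"
      by (rule order_le_less_trans) simp
    then show "F \<in> class_OS" using F pos by (auto simp: class_OS_def)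
  qed
qed

section \<open>Products with independent factors\<close>

definition prod_law :: "real measure \<Rightarrow> real measure \<Rightarrow> real measure" where
  "prod_law P Q = distr (P \<Otimes>\<^sub>M Q) borel (\<lambda>(x, y). x * y)"

lemma finite_borel_measure_prod_law:
  assumes "finite_borel_measure P" "finite_borel_measure Q"
  shows "finite_borel_measure (prod_law P Q)"
proof -
  interpret P: finite_borel_measure P by fact
  interpret Q: finite_borel_measure Q by fact
  note [measurable_cong] = P.M_is_borel Q.M_is_borel
  show ?thesis
    unfolding prod_law_def finite_borel_measure_def finite_borel_measure_axioms_def
    by (auto intro!: finite_measure.finite_measure_distr finite_measure_pair_measure
        P.finite_measure_axioms Q.finite_measure_axioms)
qed

lemma nn_integral_prod_law:
  assumes "finite_borel_measure P" "finite_borel_measure Q"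
    and [measurable]: "f \<in> borel_measurable borel"
  shows "(\<integral>\<^sup>+z. f z \<partial>prod_law P Q) = (\<integral>\<^sup>+y. \<integral>\<^sup>+x. f (x * y) \<partial>P \<partial>Q)"
proof -
  interpret P: finite_borel_measure P by fact
  interpret Q: finite_borel_measure Q by fact
  note [measurable_cong] = P.M_is_borel Q.M_is_borel
  interpret pair_sigma_finite P Q ..
  show ?thesis
    unfolding prod_law_def
    by (simp add: nn_integral_distr nn_integral_snd[symmetric])
qed

lemma emeasure_prod_law_tail:
  assumes "finite_borel_measure P" "finite_borel_measure Q" "AE y in Q. y > 0"
  shows "emeasure (prod_law P Q) {t<..} = (\<integral>\<^sup>+y. emeasure P {t / y<..} \<partial>Q)"
proof -
  interpret P: finite_borel_measure P by fact
  note [measurable_cong] = P.M_is_borel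
  have "emeasure (prod_law P Q) {t<..} = (\<integral>\<^sup>+z. indicator {t<..} z \<partial>prod_law P Q)"
    using finite_borel_measure_prod_law[OF assms(1,2)]
    by (simp add: finite_borel_measure.M_is_borel)
  also have "\<dots> = (\<integral>\<^sup>+y. \<integral>\<^sup>+x. indicator {t<..} (x * y) \<partial>P \<partial>Q)"
    by (rule nn_integral_prod_law) (use assms in auto)
  also have "\<dots> = (\<integral>\<^sup>+y. emeasure P {t / y<..} \<partial>Q)"
  proof (rule nn_integral_cong_AE, use assms(3) in eventually_elim)
    fix y :: real assume "y > 0"
    then have "(\<lambda>x. indicator {t<..} (x * y) :: ennreal) = indicator {t / y<..}"
      by (auto simp: indicator_def fun_eq_iff field_simps)
    then show "(\<integral>\<^sup>+x. indicator {t<..} (x * y) \<partial>P) = emeasure P {t / y<..}" by simp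
  qed
  finally show ?thesis .
qed

text \<open>
  If \<open>x1 * y1 + x2 * y2 > t\<close> with nonnegative \<open>x1, x2\<close>, then
  \<open>(x1 + x2) * max y1 y2 > t\<close>. Hence one of \<open>(x1 + x2) * y1\<close> and
  \<open>(x1 + x2) * y2\<close> exceeds \<open>t\<close>. Either event involves only one of \<open>y1, y2\<close>; given
  it, the event concerns \<open>P \<star> P\<close>, to which the hypothesis applies.
\<close>

lemma tail_dom_convolution_prod_law:
  assumes P: "finite_borel_measure P" and Q: "finite_borel_measure Q"
    and P_nonneg: "AE x in P. x \<ge> 0" and Q_pos: "AE y in Q. y > 0"
    and "tail_dom (P \<star> P) P"
  shows "tail_dom (prod_law P Q \<star> prod_law P Q) (prod_law P Q)"
proof -
  interpret P: finite_borel_measure P by fact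
  interpret Q: finite_borel_measure Q by fact
  interpret pair_sigma_finite P Q ..
  note [measurable_cong] = P.M_is_borel Q.M_is_borel
  let ?T = "prod_law P Q" and ?q = "emeasure Q (space Q)"
  have T: "finite_borel_measure ?T" by (rule finite_borel_measure_prod_law[OF P Q])
  interpret T: finite_borel_measure ?T by (rule T)
  note [measurable_cong] = T.M_is_borel
  obtain C where C: "C < \<top>" "\<And>t. emeasure (P \<star> P) {t<..} \<le> C * emeasure P {t<..}"
    using assms(5) unfolding tail_dom_def by auto
  have q: "?q < \<top>" by (simp add: less_top[symmetric] Q.emeasure_finite)
  have "emeasure (?T \<star> ?T) {t<..} \<le> (2 * C * ?q) * emeasure ?T {t<..}" for t
  proof -
    let ?I = "indicator {t<..} :: real \<Rightarrow> ennreal"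
    \<comment> \<open>the tail at \<open>t\<close> of \<open>(x1 + x2) * y\<close> for fixed \<open>y\<close>\<close>
    define R where "R y = (\<integral>\<^sup>+x1. \<integral>\<^sup>+x2. ?I (x1 * y + x2 * y) \<partial>P \<partial>P)" for y
    have R_meas [measurable]: "R \<in> borel_measurable borel"
      unfolding R_def by simp
    have "R y \<le> C * emeasure P {t / y<..}" if "y > 0" for y
    proof -
      have "?I (x1 * y + x2 * y) = indicator {t / y<..} (x1 + x2)" for x1 x2
        using that by (auto simp: indicator_def field_simps)
      then have "R y = emeasure (P \<star> P) {t / y<..}"
        unfolding R_def
        by (subst convolution_emeasure') (auto simp: P.finite_measure_axioms P.M_is_borel)
      then show ?thesis using C(2) by simp
    qed
    then have "(\<integral>\<^sup>+y. R y \<partial>Q) \<le> (\<integral>\<^sup>+y. C * emeasure P {t / y<..} \<partial>Q)"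
      by (intro nn_integral_mono_AE) (use Q_pos in auto)
    also have "\<dots> = C * emeasure ?T {t<..}"
    proof (subst nn_integral_cmult)
      have "(\<lambda>y. \<integral>\<^sup>+x. indicator {x. x > t / y} x \<partial>P) \<in> borel_measurable Q"
        by measurable
      then show "(\<lambda>y. emeasure P {t / y<..}) \<in> borel_measurable Q"
        by (simp add: greaterThan_def)
    qed (simp add: emeasure_prod_law_tail[OF P Q Q_pos])
    finally have R_int: "(\<integral>\<^sup>+y. R y \<partial>Q) \<le> C * emeasure ?T {t<..}" .

    have "emeasure (?T \<star> ?T) {t<..} = (\<integral>\<^sup>+a. \<integral>\<^sup>+b. ?I (a + b) \<partial>?T \<partial>?T)"
      by (rule convolution_emeasure') (auto simp: T.finite_measure_axioms T.M_is_borel)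
    also have "\<dots> = (\<integral>\<^sup>+y1. \<integral>\<^sup>+x1. \<integral>\<^sup>+y2. \<integral>\<^sup>+x2. ?I (x1 * y1 + x2 * y2) \<partial>P \<partial>Q \<partial>P \<partial>Q)"
      by (simp add: nn_integral_prod_law[OF P Q])
    also have "\<dots> \<le> (\<integral>\<^sup>+y1. \<integral>\<^sup>+x1. \<integral>\<^sup>+y2. \<integral>\<^sup>+x2.
        ?I (x1 * y1 + x2 * y1) + ?I (x1 * y2 + x2 * y2) \<partial>P \<partial>Q \<partial>P \<partial>Q)"
    proof (rule nn_integral_mono, rule nn_integral_mono_AE, use P_nonneg in eventually_elim,
        rule nn_integral_mono, rule nn_integral_mono_AE, use P_nonneg in eventually_elim)
      fix y1 x1 y2 x2 :: real assume x: "x1 \<ge> 0" "x2 \<ge> 0"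
      show "?I (x1 * y1 + x2 * y2) \<le> ?I (x1 * y1 + x2 * y1) + ?I (x1 * y2 + x2 * y2)"
      proof (cases "y2 \<le> y1")
        case True
        then have "x2 * y2 \<le> x2 * y1" using x by (intro mult_left_mono)
        then show ?thesis by (auto simp: indicator_def)
      next
        case False
        then have "x1 * y1 \<le> x1 * y2" using x by (intro mult_left_mono) auto
        then show ?thesis by (auto simp: indicator_def)
      qed
    qed
    also have "\<dots> = (\<integral>\<^sup>+y1. \<integral>\<^sup>+x1. \<integral>\<^sup>+y2. \<integral>\<^sup>+x2. ?I (x1 * y1 + x2 * y1) \<partial>P \<partial>Q \<partial>P \<partial>Q)
        + (\<integral>\<^sup>+y1. \<integral>\<^sup>+x1. \<integral>\<^sup>+y2. \<integral>\<^sup>+x2. ?I (x1 * y2 + x2 * y2) \<partial>P \<partial>Q \<partial>P \<partial>Q)"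
      by (simp add: nn_integral_add)
    also have "(\<integral>\<^sup>+y1. \<integral>\<^sup>+x1. \<integral>\<^sup>+y2. \<integral>\<^sup>+x2. ?I (x1 * y1 + x2 * y1) \<partial>P \<partial>Q \<partial>P \<partial>Q)
        = (\<integral>\<^sup>+y. R y \<partial>Q) * ?q"
      by (simp add: R_def nn_integral_multc)
    also have "(\<integral>\<^sup>+y1. \<integral>\<^sup>+x1. \<integral>\<^sup>+y2. \<integral>\<^sup>+x2. ?I (x1 * y2 + x2 * y2) \<partial>P \<partial>Q \<partial>P \<partial>Q)
        = (\<integral>\<^sup>+y. R y \<partial>Q) * ?q"
      unfolding R_def by (subst (2) Fubini') (simp_all add: mult.commute)
    also have "(\<integral>\<^sup>+y. R y \<partial>Q) * ?q + (\<integral>\<^sup>+y. R y \<partial>Q) * ?q = 2 * ?q * (\<integral>\<^sup>+y. R y \<partial>Q)"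
      by (simp add: mult.commute mult_2 distrib_right distrib_left)
    also have "\<dots> \<le> 2 * ?q * (C * emeasure ?T {t<..})"
      using R_int by (intro mult_left_mono) auto
    finally show ?thesis by (simp add: ac_simps)
  qed
  moreover have "2 * C * ?q < \<top>" using C q by (simp add: ennreal_mult_less_top)
  ultimately show ?thesis unfolding tail_dom_def by blast
qed

section \<open>Supports and conditional laws\<close>

text \<open>
  The complement of the support is a union of open null sets. By Lindelof's theorem countably
  many of them suffice.
\<close>

lemma AE_in_supp:
  assumes "finite_borel_measure G"
  shows "AE y in G. y \<in> supp G"
proof -
  interpret finite_borel_measure G by fact
  let ?N = "{U. open U \<and> measure G U = 0}"
  obtain N where N: "N \<subseteq> ?N" "countable N" "\<Union>N = \<Union>?N"
    using Lindelof[of ?N] by auto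
  have "emeasure G (\<Union>N) = 0"
  proof -
    have "(\<Union>U\<in>N. id U) \<in> null_sets G"
      using N(1,2) by (intro null_sets_UN') (auto simp: null_sets_def emeasure_eq_measure M_is_borel)
    then show ?thesis by (simp add: null_sets_def)
  qed
  moreover have "{y \<in> space G. y \<notin> supp G} \<subseteq> \<Union>N"
  proof
    fix y assume "y \<in> {y \<in> space G. y \<notin> supp G}"
    then obtain U where "open U" "y \<in> U" "\<not> measure G U > 0" unfolding supp_def by auto
    then have "U \<in> ?N" using measure_nonneg[of G U] by auto
    then show "y \<in> \<Union>N" using \<open>y \<in> U\<close> N(3) by blast
  qed
  moreover have "\<Union>N \<in> sets G" using N(1) by (auto intro!: borel_open simp: M_is_borel)
  ultimately show ?thesis by (intro AE_I) auto
qed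

text \<open>
  A regular conditional distribution is specified on rectangles only. Rectangles form an
  intersection-stable generator, so the joint law is the mixture of the conditional laws on all
  Borel sets of the plane, in particular on the region \<open>x * y > t\<close> needed for the product.
\<close>

lemma emeasure_joint_law:
  assumes "prob_space M"
    and [measurable]: "X \<in> borel_measurable M" "Y \<in> borel_measurable M"
    and K: "regular_cond_distr M X Y K"
    and [measurable]: "S \<in> sets (borel \<Otimes>\<^sub>M borel)"
  shows "emeasure (distr M (borel \<Otimes>\<^sub>M borel) (\<lambda>\<omega>. (X \<omega>, Y \<omega>))) S
    = (\<integral>\<^sup>+y. emeasure (K y) {x. (x, y) \<in> S} \<partial>distr M borel Y)"
proof -
  interpret prob_space M by fact
  let ?B = "borel \<Otimes>\<^sub>M borel :: (real \<times> real) measure"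
  let ?G = "distr M borel Y" and ?J = "distr M ?B (\<lambda>\<omega>. (X \<omega>, Y \<omega>))"
  have K_meas: "K \<in> borel \<rightarrow>\<^sub>M prob_algebra borel"
    using K by (simp add: regular_cond_distr_def)
  have [measurable]: "K \<in> borel \<rightarrow>\<^sub>M subprob_algebra borel"
    by (rule measurable_prob_algebraD[OF K_meas])
  have K_prob: "prob_space (K y)" and K_sets: "sets (K y) = sets borel" for y
    using measurable_space[OF K_meas, of y] by (auto simp: space_prob_algebra)
  interpret G: prob_space ?G by (rule prob_space_distr) simp
  define J' where "J' = ?G \<bind> (\<lambda>y. K y \<Otimes>\<^sub>M return borel y)"
  have kernel [measurable]: "(\<lambda>y. K y \<Otimes>\<^sub>M return borel y) \<in> ?G \<rightarrow>\<^sub>M subprob_algebra ?B"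
    by (intro measurable_pair_measure) measurable
  have J'_sets: "sets J' = sets ?B"
    unfolding J'_def by (rule sets_bind) (auto simp: sets_kernel[OF kernel] K_sets intro!: sets_pair_measure_cong)
  have J'_eq: "emeasure J' S = (\<integral>\<^sup>+y. emeasure (K y) {x. (x, y) \<in> S} \<partial>?G)"
    if S [measurable]: "S \<in> sets ?B" for S
  proof -
    have "emeasure (K y \<Otimes>\<^sub>M return borel y) S = emeasure (K y) {x. (x, y) \<in> S}" for y
    proof -
      interpret K: prob_space "K y" by (rule K_prob)
      interpret R: prob_space "return borel y" by (rule prob_space_return) simp
      note [measurable_cong] = K_sets
      have "S \<in> sets (K y \<Otimes>\<^sub>M return borel y)"
        using S by (simp add: K_sets cong: sets_pair_measure_cong)
      then have "emeasure (K y \<Otimes>\<^sub>M return borel y) S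
          = (\<integral>\<^sup>+x. emeasure (return borel y) (Pair x -` S) \<partial>K y)"
        by (rule R.emeasure_pair_measure_alt)
      also have "\<dots> = (\<integral>\<^sup>+x. indicator {x. (x, y) \<in> S} x \<partial>K y)"
        by (intro nn_integral_cong) (simp add: sets_Pair1[OF S] indicator_def)
      also have "\<dots> = emeasure (K y) {x. (x, y) \<in> S}"
      proof (rule nn_integral_indicator)
        have "(\<lambda>x. (x, y)) -` S \<in> sets borel" by (rule sets_Pair2[OF S])
        then show "{x. (x, y) \<in> S} \<in> sets (K y)" by (simp add: K_sets vimage_def)
      qed
      finally show ?thesis .
    qed
    then show ?thesis
      unfolding J'_def by (subst emeasure_bind[OF _ kernel S]) auto
  qed
  let ?E = "{A \<times> B |A B. A \<in> sets (borel :: real measure) \<and> B \<in> sets (borel :: real measure)}"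
  have B_sets: "sets ?B = sigma_sets UNIV ?E"
    using sets_pair_measure[of "borel :: real measure" "borel :: real measure"] by simp
  have "?J = J'"
  proof (rule measure_eqI_generator_eq[OF Int_stable_pair_measure_generator[of borel borel],
        where \<Omega> = UNIV and A = "\<lambda>_. UNIV"])
    fix R assume "R \<in> ?E"
    then obtain A B where R: "R = A \<times> B" and AB [measurable]: "A \<in> sets borel" "B \<in> sets borel"
      by auto
    have "emeasure ?J R = emeasure M {\<omega> \<in> space M. X \<omega> \<in> A \<and> Y \<omega> \<in> B}"
      unfolding R by (subst emeasure_distr) (auto intro!: arg_cong[where f = "emeasure M"])
    also have "\<dots> = ennreal (\<integral>y. indicator B y *\<^sub>R measure (K y) A \<partial>?G)"
      using K AB by (simp add: regular_cond_distr_def emeasure_eq_measure set_lebesgue_integral_def)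
    also have "\<dots> = (\<integral>\<^sup>+y. ennreal (indicator B y *\<^sub>R measure (K y) A) \<partial>?G)"
    proof (rule nn_integral_eq_integral[symmetric])
      show "integrable ?G (\<lambda>y. indicator B y *\<^sub>R measure (K y) A)"
      proof (rule G.integrable_const_bound[where B = 1])
        show "AE y in ?G. norm (indicator B y *\<^sub>R measure (K y) A) \<le> 1"
          using prob_space.prob_le_1[OF K_prob] by (auto simp: indicator_def)
      qed measurable
    qed auto
    also have "\<dots> = (\<integral>\<^sup>+y. emeasure (K y) {x. (x, y) \<in> R} \<partial>?G)"
    proof (rule nn_integral_cong)
      fix y
      interpret K: prob_space "K y" by (rule K_prob)
      show "ennreal (indicator B y *\<^sub>R measure (K y) A) = emeasure (K y) {x. (x, y) \<in> R}"
        unfolding R by (auto simp: indicator_def K.emeasure_eq_measure)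
    qed
    also have "\<dots> = emeasure J' R" unfolding R by (rule J'_eq[symmetric]) simp
    finally show "emeasure ?J R = emeasure J' R" .
  next
    have "UNIV \<in> ?E"
      by (rule CollectI, rule exI[of _ UNIV], rule exI[of _ UNIV]) simp
    then show "range (\<lambda>_::nat. UNIV) \<subseteq> ?E" by blast
  next
    interpret J: prob_space ?J by (rule prob_space_distr) simp
    show "emeasure ?J UNIV \<noteq> \<infinity>" by simp
  next
    show "sets ?J = sigma_sets UNIV ?E" by (simp only: sets_distr B_sets)
    show "sets J' = sigma_sets UNIV ?E" by (simp only: J'_sets B_sets)
  qed simp_all
  then show ?thesis using J'_eq[OF assms(5)] by simp
qed

section \<open>Conditional tails proportional to the tail of the first factor\<close>

text \<open>
  The fact \<open>uniform\<close> is the convergence of the supremum, spelled out for real numbers.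
\<close>

locale conditional_tails = prob_space M for M :: "'a measure" +
  fixes X Y :: "'a \<Rightarrow> real" and K :: "real \<Rightarrow> real measure" and h :: "real \<Rightarrow> real"
    and F G H :: "real measure"
  assumes X_meas [measurable]: "X \<in> borel_measurable M"
    and Y_meas [measurable]: "Y \<in> borel_measurable M"
    and F_eq: "F = distr M borel X" and G_eq: "G = distr M borel Y"
    and H_eq: "H = distr M borel (\<lambda>\<omega>. X \<omega> * Y \<omega>)"
    and F_tail_pos: "\<And>t. tail F t > 0"
    and G_nonneg: "AE y in G. y \<ge> 0" and G_pos: "tail G 0 > 0"
    and cond_distr: "regular_cond_distr M X Y K"
    and G_negligible: "\<And>c. c > 0 \<Longrightarrow> (\<lambda>x. tail G (c * x)) \<in> o[at_top](\<lambda>x. tail H x)"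
    and h_pos: "\<And>y. y \<ge> 0 \<Longrightarrow> h y > 0"
    and uniform: "\<And>\<epsilon>. \<epsilon> > 0 \<Longrightarrow> \<exists>t0. \<forall>t\<ge>t0. \<forall>y\<in>supp G.
      \<bar>measure (K y) {t<..} / (h y * tail F t) - 1\<bar> < \<epsilon>"
begin

lemma K_measurable: "K \<in> borel \<rightarrow>\<^sub>M prob_algebra borel"
  using cond_distr by (simp add: regular_cond_distr_def)

lemma K_subprob [measurable]: "K \<in> borel \<rightarrow>\<^sub>M subprob_algebra borel"
  by (rule measurable_prob_algebraD[OF K_measurable])

lemma K_real_distribution: "real_distribution (K y)"
  using measurable_space[OF K_measurable, of y]
  by (auto simp: space_prob_algebra real_distribution_def real_distribution_axioms_def)

lemma real_distributions: "real_distribution F" "real_distribution G" "real_distribution H"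
  unfolding F_eq G_eq H_eq by (intro real_distribution_distr; measurable)+

lemma finite_borel_measures:
  "finite_borel_measure F" "finite_borel_measure G" "finite_borel_measure H"
  using real_distributions by (simp_all add: real_distribution.finite_borel_measure_M)

lemma sets_G [measurable_cong]: "sets G = sets borel"
  by (simp add: G_eq)

lemmas F_tail = real_distribution_emeasure_tail[OF real_distributions(1)]
  and G_tail = real_distribution_emeasure_tail[OF real_distributions(2)]
  and H_tail = real_distribution_emeasure_tail[OF real_distributions(3)]

lemma K_tail: "emeasure (K y) {t<..} = ennreal (measure (K y) {t<..})"
  using K_real_distribution[of y]
  by (simp add: finite_measure.emeasure_eq_measure prob_space.finite_measure real_distribution_def)

lemma K_tail_measurable [measurable]:
  "(\<lambda>y. emeasure (K y) {t / y<..}) \<in> borel_measurable borel"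
proof -
  interpret K: real_distribution "K y" for y by (rule K_real_distribution)
  have "(\<lambda>y. \<integral>\<^sup>+x. indicator {z. fst z > t / snd z} (x, y) \<partial>K y) \<in> borel_measurable borel"
    by (rule nn_integral_measurable_subprob_algebra2[OF _ K_subprob]) measurable
  moreover have "(\<integral>\<^sup>+x. indicator {z. fst z > t / snd z} (x, y) \<partial>K y) = emeasure (K y) {t / y<..}" for y
  proof -
    have "(\<lambda>x. indicator {z. fst z > t / snd z} (x, y) :: ennreal) = indicator {t / y<..}"
      by (auto simp: indicator_def fun_eq_iff)
    then show ?thesis by simp
  qed
  ultimately show ?thesis by simp
qed

text \<open>
  The restriction to \<open>t \<ge> 0\<close> makes \<open>y = 0\<close> contribute nothing; dividing by \<open>y\<close> is
  meaningful only on \<open>{0<..}\<close>.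
\<close>

lemma H_tail_eq:
  assumes "t \<ge> 0"
  shows "emeasure H {t<..} = (\<integral>\<^sup>+y. emeasure (K y) {t / y<..} * indicator {0<..} y \<partial>G)"
proof -
  let ?S = "{z :: real \<times> real. fst z * snd z > t}"
  have "{z \<in> space (borel \<Otimes>\<^sub>M borel). fst z * snd z > t} \<in> sets (borel \<Otimes>\<^sub>M borel :: (real \<times> real) measure)"
    by measurable
  then have S: "?S \<in> sets (borel \<Otimes>\<^sub>M borel)" by (simp add: space_pair_measure)
  have "emeasure H {t<..} = emeasure M {\<omega> \<in> space M. X \<omega> * Y \<omega> > t}"
    unfolding H_eq by (subst emeasure_distr) (auto intro!: arg_cong[where f = "emeasure M"])
  also have "\<dots> = emeasure (distr M (borel \<Otimes>\<^sub>M borel) (\<lambda>\<omega>. (X \<omega>, Y \<omega>))) ?S"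
    using S by (subst emeasure_distr) (auto intro!: arg_cong[where f = "emeasure M"])
  also have "\<dots> = (\<integral>\<^sup>+y. emeasure (K y) {x. x * y > t} \<partial>G)"
    unfolding G_eq
    by (subst emeasure_joint_law[OF prob_space_axioms X_meas Y_meas cond_distr S]) simp
  also have "\<dots> = (\<integral>\<^sup>+y. emeasure (K y) {t / y<..} * indicator {0<..} y \<partial>G)"
  proof (rule nn_integral_cong_AE, use G_nonneg in eventually_elim)
    fix y :: real assume "y \<ge> 0"
    then consider "y = 0" | "y > 0" by linarith
    then show "emeasure (K y) {x. x * y > t} = emeasure (K y) {t / y<..} * indicator {0<..} y"
    proof cases
      case 1
      then show ?thesis using assms by simp
    next
      case 2
      then have "{x. x * y > t} = {t / y<..}" by (auto simp: field_simps)
      then show ?thesis using 2 by simp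
    qed
  qed
  finally show ?thesis .
qed

definition near_product :: "real \<Rightarrow> real \<Rightarrow> real \<Rightarrow> bool" where
  "near_product \<epsilon> u0 y \<longleftrightarrow> h y > 0 \<and> (\<forall>u\<ge>u0.
     (1 - \<epsilon>) * (h y * tail F u) \<le> measure (K y) {u<..}
     \<and> measure (K y) {u<..} \<le> (1 + \<epsilon>) * (h y * tail F u))"

text \<open>
  The level \<open>u0\<close> is the same for all \<open>y\<close>; this is where uniformity over the support enters.
\<close>

lemma AE_near_product:
  assumes "\<epsilon> > 0"
  obtains u0 where "u0 > 0"
    "AE y in G. near_product \<epsilon> u0 y"
proof -
  obtain t0 where t0: "\<And>t y. t \<ge> t0 \<Longrightarrow> y \<in> supp G \<Longrightarrow>
      \<bar>measure (K y) {t<..} / (h y * tail F t) - 1\<bar> < \<epsilon>"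
    using uniform[OF assms] by auto
  show thesis
  proof (rule that[of "max 1 t0"])
    show "AE y in G. near_product \<epsilon> (max 1 t0) y"
      using G_nonneg AE_in_supp[OF finite_borel_measures(2)]
    proof eventually_elim
      fix y assume y: "0 \<le> y" "y \<in> supp G"
      show "near_product \<epsilon> (max 1 t0) y"
        unfolding near_product_def
      proof (intro conjI[OF h_pos[OF y(1)]] allI impI)
        fix u assume u: "max 1 t0 \<le> u"
        have pos: "h y * tail F u > 0" using h_pos[OF y(1)] F_tail_pos by simp
        have "1 - \<epsilon> < measure (K y) {u<..} / (h y * tail F u)"
          "measure (K y) {u<..} / (h y * tail F u) < 1 + \<epsilon>"
          using t0[of u y] u y by (auto simp: abs_less_iff)
        then show "(1 - \<epsilon>) * (h y * tail F u) \<le> measure (K y) {u<..}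
            \<and> measure (K y) {u<..} \<le> (1 + \<epsilon>) * (h y * tail F u)"
          using pos by (simp add: pos_less_divide_eq pos_divide_less_eq less_imp_le)
      qed
    qed
  qed simp
qed

lemma K_tail_antimono: "s \<le> t \<Longrightarrow> measure (K y) {t<..} \<le> measure (K y) {s<..}"
proof -
  interpret K: real_distribution "K y" by (rule K_real_distribution)
  show "s \<le> t \<Longrightarrow> ?thesis" by (intro K.finite_measure_mono) auto
qed

text \<open>
  Far out, conditional tails are bounded below by the positive tail of \<open>F\<close>; by monotonicity
  they are then positive everywhere.
\<close>

lemma K_tail_pos: "AE y in G. \<forall>u. measure (K y) {u<..} > 0"
proof (rule AE_near_product[of "1/2"])
  fix u0 :: real
  assume "AE y in G. near_product (1/2) u0 y"
  then show ?thesis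
  proof eventually_elim
    fix y
    assume "near_product (1/2) u0 y"
    note bounds = this[unfolded near_product_def]
    show "\<forall>u. measure (K y) {u<..} > 0"
    proof
      fix u
      have "0 < (1 - 1/2) * (h y * tail F (max u u0))" using bounds F_tail_pos[of "max u u0"] by simp
      also have "\<dots> \<le> measure (K y) {max u u0<..}" using bounds by simp
      also have "\<dots> \<le> measure (K y) {u<..}" by (intro K_tail_antimono) simp
      finally show "measure (K y) {u<..} > 0" .
    qed
  qed
qed simp

lemma H_tail_pos: "tail H t > 0"
proof -
  have "emeasure H {max 0 t<..} \<noteq> 0"
  proof
    assume "emeasure H {max 0 t<..} = 0"
    then have "AE y in G. emeasure (K y) {max 0 t / y<..} * indicator {0<..} y = 0"
      by (subst (asm) H_tail_eq, simp, subst (asm) nn_integral_0_iff_AE) measurable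
    with K_tail_pos have "AE y in G. y \<notin> {0<..}"
    proof eventually_elim
      fix y
      assume pos: "\<forall>u. measure (K y) {u<..} > 0"
        and zero: "emeasure (K y) {max 0 t / y<..} * indicator {0<..} y = 0"
      show "y \<notin> {0<..}"
        using zero pos[rule_format, of "max 0 t / y"] by (auto simp: K_tail)
    qed
    then have "emeasure G {0<..} = 0" by (subst (asm) AE_iff_measurable[OF _ refl]) (auto simp: G_eq greaterThan_def)
    then show False using G_pos by (simp add: G_tail)
  qed
  then have "0 < tail H (max 0 t)" by (simp add: H_tail ennreal_eq_0_iff not_le)
  also have "\<dots> \<le> tail H t"
    using finite_borel_measure.cdf_nondecreasing[OF finite_borel_measures(3), of t "max 0 t"]
    by (simp add: tail_def)
  finally show ?thesis .
qed

text \<open>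
  If \<open>0 < y \<le> t / u0\<close>, then \<open>t / y \<ge> u0\<close> and the estimate for the conditional tail is
  available at \<open>t / y\<close>. The remaining \<open>y\<close> have \<open>G\<close>-mass \<open>G {t / u0<..}\<close>, and
  there the conditional tail is bounded by 1. For \<open>v = 1\<close> this compares \<open>H\<close> with a product
  law; for \<open>v > 1\<close>, with its own tail at \<open>t\<close>.
\<close>

lemma H_tail_split:
  assumes "u0 > 0" "t \<ge> 0" "v > 0"
    and [measurable]: "(\<lambda>y. k y (t / y)) \<in> borel_measurable borel"
    and k: "AE y in G. \<forall>u\<ge>u0. emeasure (K y) {v * u<..} \<le> c * k y u"
  shows "emeasure H {v * t<..}
    \<le> c * (\<integral>\<^sup>+y. k y (t / y) * indicator {0<..} y \<partial>G) + emeasure G {t / u0<..}"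
proof -
  have "emeasure H {v * t<..} = (\<integral>\<^sup>+y. emeasure (K y) {v * t / y<..} * indicator {0<..} y \<partial>G)"
    using assms by (intro H_tail_eq) simp
  also have "\<dots> \<le> (\<integral>\<^sup>+y. c * (k y (t / y) * indicator {0<..} y) + indicator {t / u0<..} y \<partial>G)"
  proof (rule nn_integral_mono_AE, use k in eventually_elim)
    fix y assume y: "\<forall>u\<ge>u0. emeasure (K y) {v * u<..} \<le> c * k y u"
    interpret K: real_distribution "K y" by (rule K_real_distribution)
    consider "y \<le> 0" | "y > 0" "y \<le> t / u0" | "y > 0" "y > t / u0" by linarith
    then show "emeasure (K y) {v * t / y<..} * indicator {0<..} y
      \<le> c * (k y (t / y) * indicator {0<..} y) + indicator {t / u0<..} y"
    proof cases
      case 2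
      then have "t / y \<ge> u0" using assms by (simp add: field_simps)
      then show ?thesis using y[rule_format, of "t / y"] 2 by simp
    next
      case 3
      have "emeasure (K y) {v * t / y<..} \<le> 1" by (rule K.measure_le_1)
      also have "\<dots> \<le> c * k y (t / y) + 1" by simp
      finally show ?thesis using 3 by simp
    qed simp
  qed
  also have "\<dots> = c * (\<integral>\<^sup>+y. k y (t / y) * indicator {0<..} y \<partial>G) + emeasure G {t / u0<..}"
    by (simp add: nn_integral_add nn_integral_cmult sets_G)
  finally show ?thesis .
qed

lemma G_tail_le:
  assumes "u0 > 0" "\<delta> > 0"
  shows "eventually (\<lambda>t. tail G (t / u0) \<le> \<delta> * tail H t) at_top"
proof -
  have "tail G t \<ge> 0" for t
    unfolding tail_def using real_distribution.cdf_bounded_prob[OF real_distributions(2)] by simp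
  moreover have "eventually (\<lambda>t. norm (tail G (1 / u0 * t)) \<le> \<delta> * norm (tail H t)) at_top"
    using landau_o.smallD[OF G_negligible[of "1 / u0"]] assms by simp
  ultimately show ?thesis
    using H_tail_pos by (simp add: less_imp_le)
qed

section \<open>Positive decrease of the product\<close>

lemma H_in_class_PD:
  assumes "F \<in> class_PD"
  shows "H \<in> class_PD"
proof -
  have "Limsup at_top (\<lambda>x. ereal (tail H (v * x) / tail H x)) < 1" if v: "v > 1" for v
  proof -
    have "Limsup at_top (\<lambda>x. ereal (tail F (v * x) / tail F x)) < ereal 1"
      using assms v by (auto simp: class_PD_def simp flip: one_ereal_def)
    then obtain d0 where d0: "Limsup at_top (\<lambda>x. ereal (tail F (v * x) / tail F x)) < ereal d0" "d0 < 1"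
      using ereal_dense2[of _ "ereal 1"] by (metis less_ereal.simps(1))
    define d where "d = max d0 (1/2)"
    have d: "0 < d" "d < 1" using d0(2) by (auto simp: d_def)
    obtain t1 where t1: "\<And>t. t \<ge> t1 \<Longrightarrow> tail F (v * t) / tail F t < d0"
      using Limsup_lessD[OF d0(1)] by (auto simp: eventually_at_top_linorder)
    \<comment> \<open>Passing between conditional tails and the tail of \<open>F\<close> costs a factor
      \<open>(1 + \<epsilon>) / (1 - \<epsilon>)\<close>. The choice of \<open>\<epsilon>\<close> lets it raise the contraction factor from
      \<open>d\<close> to exactly \<open>e < 1\<close>.\<close>
    define e where "e = (1 + d) / 2"
    have e: "d < e" "e < 1" using d by (auto simp: e_def)
    define \<epsilon> where "\<epsilon> = (e - d) / (e + d)"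
    have \<epsilon>: "\<epsilon> > 0" "(1 + \<epsilon>) * d = (1 - \<epsilon>) * e"
      using d e by (auto simp: \<epsilon>_def field_simps)
    obtain u1 where u1: "u1 > 0"
      "AE y in G. near_product \<epsilon> u1 y"
      using AE_near_product[OF \<epsilon>(1)] by blast
    define u0 where "u0 = max u1 t1"
    have u0: "u0 > 0" using u1 by (simp add: u0_def)
    have K_decay: "AE y in G. \<forall>u\<ge>u0. emeasure (K y) {v * u<..} \<le> ennreal e * emeasure (K y) {u<..}"
      using u1(2)
    proof eventually_elim
      fix y
      assume "near_product \<epsilon> u1 y"
      note y = this[unfolded near_product_def]
      show "\<forall>u\<ge>u0. emeasure (K y) {v * u<..} \<le> ennreal e * emeasure (K y) {u<..}"
      proof (intro allI impI)
        fix u assume u: "u \<ge> u0"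
        have "v * u \<ge> u" using u u0 v by simp
        then have "v * u \<ge> u1" and u': "u \<ge> u1" "u \<ge> t1" using u by (auto simp: u0_def)
        then have "measure (K y) {v * u<..} \<le> (1 + \<epsilon>) * (h y * tail F (v * u))" using y by simp
        also have "\<dots> \<le> (1 + \<epsilon>) * (h y * (d * tail F u))"
        proof -
          have "tail F (v * u) \<le> d0 * tail F u"
            using t1[OF u'(2)] F_tail_pos[of u] by (simp add: pos_divide_less_eq)
          also have "\<dots> \<le> d * tail F u"
            using F_tail_pos[of u] by (intro mult_right_mono) (auto simp: d_def)
          finally show ?thesis using \<epsilon>(1) y u'(1) by (intro mult_left_mono) (auto simp: less_imp_le)
        qed
        also have "\<dots> = ((1 + \<epsilon>) * d) * (h y * tail F u)" by simp
        also have "\<dots> = ((1 - \<epsilon>) * e) * (h y * tail F u)" by (simp only: \<epsilon>(2))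
        also have "\<dots> = e * ((1 - \<epsilon>) * (h y * tail F u))" by simp
        also have "\<dots> \<le> e * measure (K y) {u<..}"
          using y u' d e by (intro mult_left_mono) auto
        finally show "emeasure (K y) {v * u<..} \<le> ennreal e * emeasure (K y) {u<..}"
          using d e by (simp add: K_tail ennreal_mult[symmetric] ennreal_leI)
      qed
    qed
    \<comment> \<open>The share of large \<open>y\<close> is at most half of the remaining gap \<open>1 - e\<close>.\<close>
    have gap: "(1 - e) / 2 > 0" using e(2) by simp
    have "eventually (\<lambda>t. tail H (v * t) / tail H t \<le> (1 + e) / 2) at_top"
      using G_tail_le[OF u0 gap] eventually_ge_at_top[of 0]
    proof eventually_elim
      fix t :: real
      assume G_le: "tail G (t / u0) \<le> (1 - e) / 2 * tail H t" and t: "0 \<le> t"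
      have "emeasure H {v * t<..} \<le> ennreal e
          * (\<integral>\<^sup>+y. emeasure (K y) {t / y<..} * indicator {0<..} y \<partial>G) + emeasure G {t / u0<..}"
        using t v by (intro H_tail_split[OF u0 _ _ _ K_decay]) auto
      also have "\<dots> = ennreal e * emeasure H {t<..} + emeasure G {t / u0<..}"
        by (simp add: H_tail_eq[OF t])
      also have "\<dots> \<le> ennreal e * ennreal (tail H t) + ennreal ((1 - e) / 2 * tail H t)"
        unfolding H_tail G_tail using G_le by (intro add_left_mono ennreal_leI)
      also have "\<dots> = ennreal ((1 + e) / 2 * tail H t)"
        using d e H_tail_pos[of t]
        by (simp add: ennreal_mult[symmetric] ennreal_plus[symmetric] field_simps del: ennreal_plus)
      finally show "tail H (v * t) / tail H t \<le> (1 + e) / 2"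
        using H_tail_pos[of t] d e by (simp add: H_tail pos_divide_le_eq)
    qed
    then have "Limsup at_top (\<lambda>x. ereal (tail H (v * x) / tail H x)) \<le> ereal ((1 + e) / 2)"
      by (intro Limsup_bounded) simp
    also have "\<dots> < 1" using e by simp
    finally show ?thesis .
  qed
  then show ?thesis using real_distributions(3) H_tail_pos by (auto simp: class_PD_def)
qed

section \<open>Generalized subexponentiality of the product\<close>

text \<open>
  Everything reduces to \<open>H \<preceq> T \<preceq> H\<close> for the independent product \<open>T\<close>
  of \<open>P\<close> (the law of the positive part of \<open>X\<close>) and \<open>Q\<close> (the measure \<open>w dG\<close> on
  \<open>{0<..}\<close>). The positive part makes the maximum trick applicable and changes the
  tail only by a bounded factor.
\<close>

lemma H_in_class_OS:
  assumes "F \<in> class_OS"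
  shows "H \<in> class_OS"
proof -
  define P where "P = distr F borel (max 0)"
  have F_sets [measurable_cong]: "sets F = sets borel" by (simp add: F_eq)
  have P_real: "real_distribution P"
    unfolding P_def using real_distributions(1)
    by (intro prob_space.real_distribution_distr) (auto simp: real_distribution_def)
  then have P_fin: "finite_borel_measure P" by (rule real_distribution.finite_borel_measure_M)
  have P_ge: "emeasure F {t<..} \<le> emeasure P {t<..}" for t
  proof -
    have "max 0 -` {t<..} \<in> sets (borel :: real measure)"
      by (rule measurable_sets_borel[where M = borel]) auto
    then show ?thesis
      unfolding P_def by (subst emeasure_distr) (auto intro!: emeasure_mono simp: F_eq)
  qed
  have P_eq: "emeasure P {t<..} = emeasure F {t<..}" if "t \<ge> 0" for t
  proof -
    have "max 0 -` {t<..} \<inter> space F = {t<..}" using that by (auto simp: F_eq)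
    then show ?thesis unfolding P_def by (subst emeasure_distr) auto
  qed
  have F_pos: "emeasure F {t<..} > 0" for t using F_tail_pos by (simp add: F_tail)
  have "tail_dom F P"
    unfolding tail_dom_def using P_ge by (intro exI[of _ 1]) simp
  moreover have "tail_dom P F"
    using F_pos P_eq
    by (intro tail_domI_eventually[where C = 1 and ?t0.0 = 0] P_fin finite_borel_measures) auto
  moreover have "tail_dom (F \<star> F) F"
    using class_OS_iff_tail_dom[OF real_distributions(1) F_tail_pos] assms by simp
  ultimately have P_OS: "tail_dom (P \<star> P) P"
    using tail_dom_convolution[OF P_fin finite_borel_measures(1)] tail_dom_trans by blast

  obtain u0 where u0: "u0 > 0"
    "AE y in G. near_product (1/2) u0 y"
    using AE_near_product[of "1/2"] half_gt_zero[OF zero_less_one] by blast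
  let ?w = "\<lambda>y. emeasure (K y) {u0<..} * indicator {0<..} y"
  define Q where "Q = density G ?w"
  have Q_sets [measurable_cong]: "sets Q = sets borel" by (simp add: Q_def G_eq)
  have "emeasure Q UNIV \<le> 1"
  proof -
    have "emeasure Q UNIV = (\<integral>\<^sup>+y. ?w y \<partial>G)"
      unfolding Q_def by (subst emeasure_density) (auto simp: G_eq)
    also have "\<dots> \<le> (\<integral>\<^sup>+y. 1 \<partial>G)"
    proof (rule nn_integral_mono)
      fix y
      interpret K: real_distribution "K y" by (rule K_real_distribution)
      show "?w y \<le> 1" using K.measure_le_1[of "{u0<..}"] by (auto simp: indicator_def)
    qed
    also have "\<dots> = 1"
      using real_distributions(2) by (simp add: real_distribution_def prob_space.emeasure_space_1)
    finally show ?thesis .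
  qed
  moreover have "space Q = UNIV" by (simp add: Q_def G_eq)
  ultimately have "finite_measure Q" by (intro finite_measureI) (auto simp: top_unique)
  then have Q_fin: "finite_borel_measure Q"
    using Q_sets by (simp add: finite_borel_measure_def finite_borel_measure_axioms_def)
  have Q_pos: "AE y in Q. y > 0"
    unfolding Q_def by (subst AE_density) (auto simp: indicator_def)
  have P_nonneg: "AE x in P. x \<ge> 0"
    unfolding P_def by (subst AE_distr_iff) auto

  define T where "T = prod_law P Q"
  have T_fin: "finite_borel_measure T"
    unfolding T_def by (rule finite_borel_measure_prod_law[OF P_fin Q_fin])
  have T_OS: "tail_dom (T \<star> T) T"
    unfolding T_def by (rule tail_dom_convolution_prod_law[OF P_fin Q_fin P_nonneg Q_pos P_OS])
  let ?k = "\<lambda>y u. emeasure (K y) {u0<..} * emeasure P {u<..}"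
  have P_meas [measurable]: "(\<lambda>y. emeasure P {t / y<..}) \<in> borel_measurable borel" for t
  proof -
    interpret P: real_distribution P by (rule P_real)
    have "(\<lambda>y. \<integral>\<^sup>+x. indicator {x. x > t / y} x \<partial>P) \<in> borel_measurable borel"
      by measurable
    then show ?thesis by (simp add: greaterThan_def)
  qed
  have T_tail: "emeasure T {t<..} = (\<integral>\<^sup>+y. ?k y (t / y) * indicator {0<..} y \<partial>G)" for t
    unfolding T_def emeasure_prod_law_tail[OF P_fin Q_fin Q_pos] unfolding Q_def
    by (subst nn_integral_density) (auto intro!: nn_integral_cong simp: mult_ac)

  \<comment> \<open>The conditional tails at \<open>u0\<close> and at \<open>u \<ge> u0\<close> are both comparable to \<open>h y\<close>
    times a tail of \<open>F\<close>, the constants \<open>1/2\<close> and \<open>3/2\<close> giving the ratio 3. For \<open>u < u0\<close> monotonicity suffices.\<close>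
  have lower: "AE y in G. \<forall>u\<ge>0. ?k y u \<le> 3 * emeasure (K y) {u<..}"
    using u0(2)
  proof eventually_elim
    fix y
    assume "near_product (1/2) u0 y"
    note y = this[unfolded near_product_def]
    have F_le_1: "tail F u \<le> 1" for u
      by (simp add: tail_def finite_borel_measure.cdf_nonneg[OF finite_borel_measures(1)])
    show "\<forall>u\<ge>0. ?k y u \<le> 3 * emeasure (K y) {u<..}"
    proof (intro allI impI)
      fix u :: real assume u: "u \<ge> 0"
      have "measure (K y) {u0<..} * tail F u \<le> 3 * measure (K y) {u<..}"
      proof (cases "u \<ge> u0")
        case True
        have "measure (K y) {u0<..} * tail F u \<le> (1 + 1/2) * (h y * tail F u0) * tail F u"
          using y F_tail_pos[of u] by (intro mult_right_mono) (auto simp: less_imp_le)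
        also have "\<dots> = 3 * tail F u0 * ((1 - 1/2) * (h y * tail F u))" by simp
        also have "\<dots> \<le> 3 * 1 * measure (K y) {u<..}"
          using y True F_le_1[of u0] F_tail_pos[of u] F_tail_pos[of u0]
          by (intro mult_mono) (auto simp: less_imp_le)
        finally show ?thesis by simp
      next
        case False
        have "measure (K y) {u0<..} * tail F u \<le> measure (K y) {u<..} * 1"
          using False F_le_1 F_tail_pos[of u]
          by (intro mult_mono K_tail_antimono) (auto simp: less_imp_le)
        then show ?thesis using measure_nonneg[of "K y" "{u<..}"] by linarith
      qed
      from ennreal_leI[OF this] show "?k y u \<le> 3 * emeasure (K y) {u<..}"
        using F_tail_pos[of u] by (simp add: P_eq[OF u] F_tail K_tail ennreal_mult' ennreal_mult'')
    qed
  qed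
  \<comment> \<open>The bound in \<open>lower\<close> drops \<open>tail F u0 \<le> 1\<close>, which reappears here as a divisor.\<close>
  define c where "c = 3 / tail F u0"
  have c: "c > 0" using F_tail_pos[of u0] by (simp add: c_def)
  have upper: "AE y in G. \<forall>u\<ge>u0. emeasure (K y) {1 * u<..} \<le> ennreal c * ?k y u"
    using u0(2)
  proof eventually_elim
    fix y
    assume "near_product (1/2) u0 y"
    note y = this[unfolded near_product_def]
    show "\<forall>u\<ge>u0. emeasure (K y) {1 * u<..} \<le> ennreal c * ?k y u"
    proof (intro allI impI)
      fix u assume u: "u \<ge> u0"
      have "measure (K y) {u<..} \<le> (1 + 1/2) * (h y * tail F u)" using y u by simp
      also have "\<dots> = c * (((1 - 1/2) * (h y * tail F u0)) * tail F u)"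
        using F_tail_pos[of u0] by (simp add: c_def)
      also have "\<dots> \<le> c * (measure (K y) {u0<..} * tail F u)"
        using c y F_tail_pos[of u] by (intro mult_left_mono mult_right_mono) (auto simp: less_imp_le)
      finally have "ennreal (measure (K y) {u<..}) \<le> ennreal (c * (measure (K y) {u0<..} * tail F u))"
        by (rule ennreal_leI)
      then show "emeasure (K y) {1 * u<..} \<le> ennreal c * ?k y u"
        using u u0(1) c F_tail_pos[of u] by (simp add: P_eq F_tail K_tail ennreal_mult)
    qed
  qed

  have H_pos: "emeasure H {t<..} > 0" for t using H_tail_pos by (simp add: H_tail)
  have T_H: "tail_dom T H"
  proof (rule tail_domI_eventually[OF T_fin finite_borel_measures(3) H_pos, where C = 3 and ?t0.0 = 0])
    fix t :: real assume t: "t \<ge> 0"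
    have "emeasure T {t<..} \<le> (\<integral>\<^sup>+y. 3 * (emeasure (K y) {t / y<..} * indicator {0<..} y) \<partial>G)"
      unfolding T_tail
    proof (rule nn_integral_mono_AE, use lower in eventually_elim)
      fix y assume "\<forall>u\<ge>0. ?k y u \<le> 3 * emeasure (K y) {u<..}"
      then show "?k y (t / y) * indicator {0<..} y
          \<le> 3 * (emeasure (K y) {t / y<..} * indicator {0<..} y)"
        using t by (auto simp: indicator_def)
    qed
    also have "\<dots> = 3 * emeasure H {t<..}" by (simp add: H_tail_eq[OF t] nn_integral_cmult)
    finally show "emeasure T {t<..} \<le> 3 * emeasure H {t<..}" .
  qed simp

  obtain t0 where t0: "\<And>t. t \<ge> t0 \<Longrightarrow> tail G (t / u0) \<le> 1/2 * tail H t"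
    using G_tail_le[OF u0(1), of "1/2"] by (auto simp: eventually_at_top_linorder)
  \<comment> \<open>The \<open>G\<close>-term is at most half the left-hand side and is absorbed, at the price of a
    factor 2.\<close>
  have H_le_T: "emeasure H {t<..} \<le> ennreal (2 * c) * emeasure T {t<..}" if "t \<ge> max 0 t0" for t
  proof -
    interpret T: finite_borel_measure T by (rule T_fin)
    have "emeasure H {1 * t<..} \<le> ennreal c * emeasure T {t<..} + emeasure G {t / u0<..}"
      unfolding T_tail using that by (intro H_tail_split[OF u0(1) _ _ _ upper]) auto
    also have "\<dots> \<le> ennreal c * emeasure T {t<..} + ennreal (1/2 * tail H t)"
      unfolding G_tail using that t0 by (intro add_left_mono ennreal_leI) auto
    also have "\<dots> = ennreal (c * measure T {t<..} + 1/2 * tail H t)"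
      using c H_tail_pos[of t] by (simp add: T.emeasure_eq_measure ennreal_mult[symmetric] ennreal_plus[symmetric] del: ennreal_plus)
    finally have "tail H t \<le> c * measure T {t<..} + 1/2 * tail H t"
      using c H_tail_pos[of t] by (simp add: H_tail del: ennreal_plus)
    then have "tail H t \<le> 2 * c * measure T {t<..}" by simp
    from ennreal_leI[OF this] show ?thesis
      using c by (simp add: H_tail T.emeasure_eq_measure ennreal_mult)
  qed
  have H_T: "tail_dom H T"
  proof (rule tail_domI_eventually[OF finite_borel_measures(3) T_fin _ _ H_le_T])
    fix t
    let ?s = "max t (max 0 t0)"
    have "0 < ennreal (2 * c) * emeasure T {?s<..}"
      using H_pos[of ?s] H_le_T[of ?s] by (rule order_less_le_trans) simp
    then have "0 < emeasure T {?s<..}" by (simp add: ennreal_zero_less_mult_iff)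
    also have "\<dots> \<le> emeasure T {t<..}"
      by (intro emeasure_mono) (auto simp: finite_borel_measure.M_is_borel[OF T_fin])
    finally show "0 < emeasure T {t<..}" .
  qed simp
  have "tail_dom (H \<star> H) H"
    using tail_dom_convolution[OF finite_borel_measures(3) T_fin H_T] T_OS T_H tail_dom_trans
    by blast
  then show ?thesis
    using class_OS_iff_tail_dom[OF real_distributions(3) H_tail_pos] by simp
qed

end

theorem theorem2p3:
  fixes M :: "'a measure" and X Y :: "'a \<Rightarrow> real"
    and F G H :: "real measure" and K :: "real \<Rightarrow> real measure"
  assumes "prob_space M"
    and "X \<in> borel_measurable M" and "Y \<in> borel_measurable M"
    and "F = distr M borel X" and "G = distr M borel Y"
    and "H = distr M borel (\<lambda>\<omega>. X \<omega> * Y \<omega>)"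
    and "supp F = UNIV"
    and "(cdf G \<longlongrightarrow> 0) (at_left 0)" and "cdf G 0 < 1"
    and "regular_cond_distr M X Y K"
    and A: "\<forall>c>0. (\<lambda>x. tail G (c * x)) \<in> o[at_top](\<lambda>x. tail H x)"
    and B: "\<exists>h :: real \<Rightarrow> real. (\<forall>y\<ge>0. h y > 0) \<and>
      ((\<lambda>x. SUP y\<in>supp G. ereal \<bar>measure (K y) {x<..} / (h y * \<P>(\<omega> in M. X \<omega> > x)) - 1\<bar>)
        \<longlongrightarrow> 0) at_top"
  shows "(F \<in> class_OS \<longrightarrow> H \<in> class_OS) \<and> (F \<in> class_OA \<longrightarrow> H \<in> class_OA)"
proof -
  interpret prob_space M by fact
  note [measurable] = assms(2,3)
  obtain h :: "real \<Rightarrow> real" where h_pos: "\<And>y. y \<ge> 0 \<Longrightarrow> h y > 0"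
    and h: "((\<lambda>x. SUP y\<in>supp G. ereal \<bar>measure (K y) {x<..} / (h y * \<P>(\<omega> in M. X \<omega> > x)) - 1\<bar>)
        \<longlongrightarrow> 0) at_top"
    using B by auto
  have F: "real_distribution F" and G: "real_distribution G"
    unfolding assms(4,5) by (intro real_distribution_distr; measurable)+
  interpret F: real_distribution F by (rule F)
  interpret G: real_distribution G by (rule G)
  have F_tail: "tail F t = measure F {t<..}" for t
    using real_distribution_emeasure_tail[OF F, of t] F.cdf_bounded_prob[of t]
    by (simp add: F.emeasure_eq_measure tail_def)
  have X_tail: "\<P>(\<omega> in M. X \<omega> > t) = tail F t" for t
    unfolding F_tail unfolding assms(4)
    by (subst measure_distr) (auto intro!: arg_cong[where f = prob])
  interpret conditional_tails M X Y K h F G H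
  proof
    fix t
    have "t + 1 \<in> supp F" by (simp add: assms(7))
    moreover have "open {t<..}" "t + 1 \<in> {t<..}" by auto
    ultimately show "tail F t > 0" unfolding supp_def F_tail by blast
  next
    have "measure G {..<0} = 0"
      using tendsto_unique[OF _ G.cdf_at_left assms(8)] by simp
    then have "AE y in G. y \<notin> {..<0}"
      by (subst AE_iff_measurable[OF _ refl]) (auto simp: G.emeasure_eq_measure lessThan_def)
    then show "AE y in G. y \<ge> 0" by eventually_elim simp
  next
    show "tail G 0 > 0" using assms(9) by (simp add: tail_def)
  next
    fix \<epsilon> :: real assume "\<epsilon> > 0"
    then have "eventually (\<lambda>x. (SUP y\<in>supp G.
        ereal \<bar>measure (K y) {x<..} / (h y * tail F x) - 1\<bar>) < ereal \<epsilon>) at_top"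
      using order_tendstoD(2)[OF h, of "ereal \<epsilon>"] by (simp add: X_tail)
    then show "\<exists>t0. \<forall>t\<ge>t0. \<forall>y\<in>supp G. \<bar>measure (K y) {t<..} / (h y * tail F t) - 1\<bar> < \<epsilon>"
      unfolding eventually_at_top_linorder
      by (meson SUP_upper order_le_less_trans less_ereal.simps(1))
  qed (use assms A h_pos in auto)
  show ?thesis using H_in_class_OS H_in_class_PD by (auto simp: class_OA_def)
qed

end
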